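(* Let $a<b$ be real numbers and let $m\in\mathbb{N}$, $m>1$. The linear operator $$C^m([a,b])\to\prod_{j=0}^{m-1}L^2(\{a,b\}),\qquad u\mapsto\big(u|_{\{a,b\}},u'|_{\{a,b\}},\dots,u^{(m-1)}|_{\{a,b\}}\big),$$ admits a unique extension to a bounded linear operator $$T_{m-1}:H^m(a,b)\to\prod_{j=0}^{m-1}L^2(\{a,b\}),\qquad T_{m-1}u=(\gamma_0u,\gamma_1u,\dots,\gamma_{m-1}u),$$ where $\gamma_ju=u^{(j)}|_{\{a,b\}}$ for $j=0,1,\dots,m-1$ and $u\in C^m([a,b])$.
   Context: For $m\in\mathbb{N}$, $C^m([a,b])$ is the set of all complex-valued $m$ times continuously differentiable functions on $[a,b]$, and $u^{(j)}$ is the derivative of order $j$ of $u$. The space $H^m(a,b)$ is the completion of $C^m([a,b])$ with respect to the norm $$\|u\|_{H^m(a,b)}:=\Big(\sum_{j=0}^m\int_a^b|u^{(j)}(x)|^2\,dx\Big)^{1/2};$$ its elements are identified with the functions in $L^2(a,b)$ whose (weak) derivatives up to order $m$ also belong to $L^2(a,b)$. $L^2(\{a,b\})$ is the space of all functions $\varphi:\{a,b\}\to\mathbb{C}$, endowed with the norm $\|\varphi\|_{L^2(\{a,b\})}:=\big(|\varphi(a)|^2+|\varphi(b)|^2\big)^{1/2}$. The space $\prod_{j=0}^{m-1}L^2(\{a,b\})$ is the Cartesian product of $m$ copies of $L^2(\{a,b\})$ with the usual product topology, normed by $\|(\varphi_0,\dots,\varphi_{m-1})\|:=\big(\sum_{k=0}^{m-1}\|\varphi_k\|_{L^2(\{a,b\})}^2\big)^{1/2}$.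 *)

theory Defs
  imports "HOL-Analysis.Analysis"
begin

section \<open>Complex normed spaces on explicit carriers\<close>

text \<open>The spaces in question depend on the values \<open>a\<close>, \<open>b\<close> and \<open>m\<close>, so they cannot be types.\<close>

record 'v cnspace =
  carr :: "'v set"
  zro :: 'v
  add :: "'v \<Rightarrow> 'v \<Rightarrow> 'v"
  scl :: "complex \<Rightarrow> 'v \<Rightarrow> 'v"
  nrm :: "'v \<Rightarrow> real"

definition dst :: "'v cnspace \<Rightarrow> 'v \<Rightarrow> 'v \<Rightarrow> real" where
  "dst E u v = nrm E (add E u (scl E (-1) v))"

locale complex_normed_space =
  fixes E :: "'v cnspace"
  assumes zro_closed: "zro E \<in> carr E"
    and add_closed: "\<lbrakk>u \<in> carr E; v \<in> carr E\<rbrakk> \<Longrightarrow> add E u v \<in> carr E"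
    and scl_closed: "u \<in> carr E \<Longrightarrow> scl E c u \<in> carr E"
    and add_assoc: "\<lbrakk>u \<in> carr E; v \<in> carr E; w \<in> carr E\<rbrakk> \<Longrightarrow> add E (add E u v) w = add E u (add E v w)"
    and add_comm: "\<lbrakk>u \<in> carr E; v \<in> carr E\<rbrakk> \<Longrightarrow> add E u v = add E v u"
    and zro_add: "u \<in> carr E \<Longrightarrow> add E (zro E) u = u"
    and add_neg: "u \<in> carr E \<Longrightarrow> add E u (scl E (-1) u) = zro E"
    and scl_one: "u \<in> carr E \<Longrightarrow> scl E 1 u = u"
    and scl_scl: "u \<in> carr E \<Longrightarrow> scl E c (scl E d u) = scl E (c * d) u"
    and scl_add: "\<lbrakk>u \<in> carr E; v \<in> carr E\<rbrakk> \<Longrightarrow> scl E c (add E u v) = add E (scl E c u) (scl E c v)"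
    and scl_plus: "u \<in> carr E \<Longrightarrow> scl E (c + d) u = add E (scl E c u) (scl E d u)"
    and nrm_triangle: "\<lbrakk>u \<in> carr E; v \<in> carr E\<rbrakk> \<Longrightarrow> nrm E (add E u v) \<le> nrm E u + nrm E v"
    and nrm_scl: "u \<in> carr E \<Longrightarrow> nrm E (scl E c u) = cmod c * nrm E u"
    and nrm_eq_0: "\<lbrakk>u \<in> carr E; nrm E u = 0\<rbrakk> \<Longrightarrow> u = zro E"

text \<open>Membership in \<open>carr E \<rightarrow>\<^sub>E carr F\<close> fixes the value of \<open>T\<close> outside its domain, so that
  equality of operators is equality on \<open>carr E\<close>.\<close>

definition linear_op :: "'v cnspace \<Rightarrow> 'w cnspace \<Rightarrow> ('v \<Rightarrow> 'w) \<Rightarrow> bool" where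
  "linear_op E F T \<longleftrightarrow>
     T \<in> carr E \<rightarrow>\<^sub>E carr F \<and>
     (\<forall>u\<in>carr E. \<forall>v\<in>carr E. T (add E u v) = add F (T u) (T v)) \<and>
     (\<forall>c. \<forall>u\<in>carr E. T (scl E c u) = scl F c (T u))"

definition bounded_linear_op :: "'v cnspace \<Rightarrow> 'w cnspace \<Rightarrow> ('v \<Rightarrow> 'w) \<Rightarrow> bool" where
  "bounded_linear_op E F T \<longleftrightarrow>
     linear_op E F T \<and> (\<exists>C. \<forall>u\<in>carr E. nrm F (T u) \<le> C * nrm E u)"


section \<open>Completion of a normed space\<close>

definition cauchy_seqs :: "'v cnspace \<Rightarrow> (nat \<Rightarrow> 'v) set" where
  "cauchy_seqs E = {X. (\<forall>n. X n \<in> carr E) \<and>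
     (\<forall>e>0. \<exists>N. \<forall>i\<ge>N. \<forall>j\<ge>N. dst E (X i) (X j) < e)}"

definition null_rel :: "'v cnspace \<Rightarrow> ((nat \<Rightarrow> 'v) \<times> (nat \<Rightarrow> 'v)) set" where
  "null_rel E = {(X, Y). X \<in> cauchy_seqs E \<and> Y \<in> cauchy_seqs E \<and>
     (\<lambda>n. dst E (X n) (Y n)) \<longlonglongrightarrow> 0}"

definition cls :: "'v cnspace \<Rightarrow> (nat \<Rightarrow> 'v) \<Rightarrow> (nat \<Rightarrow> 'v) set" where
  "cls E X = null_rel E `` {X}"

definition cauchy_completion :: "'v cnspace \<Rightarrow> (nat \<Rightarrow> 'v) set cnspace" where
  "cauchy_completion E = \<lparr>
     carr = cauchy_seqs E // null_rel E,
     zro = cls E (\<lambda>n. zro E),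
     add = (\<lambda>A B. \<Union>X\<in>A. \<Union>Y\<in>B. cls E (\<lambda>n. add E (X n) (Y n))),
     scl = (\<lambda>c A. \<Union>X\<in>A. cls E (\<lambda>n. scl E c (X n))),
     nrm = (\<lambda>A. THE r. \<forall>X\<in>A. (\<lambda>n. nrm E (X n)) \<longlonglongrightarrow> r)\<rparr>"

definition to_completion :: "'v cnspace \<Rightarrow> 'v \<Rightarrow> (nat \<Rightarrow> 'v) set" where
  "to_completion E u = cls E (\<lambda>n. u)"


section \<open>The spaces \<open>C\<^sup>m([a,b])\<close> and \<open>H\<^sup>m(a,b)\<close>\<close>

text \<open>Derivatives on \<open>[a,b]\<close>; at the end points they are one-sided.\<close>

primrec nderiv :: "real \<Rightarrow> real \<Rightarrow> nat \<Rightarrow> (real \<Rightarrow> complex) \<Rightarrow> real \<Rightarrow> complex" where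
  "nderiv a b 0 u = u"
| "nderiv a b (Suc j) u = (\<lambda>x. vector_derivative (nderiv a b j u) (at x within {a..b}))"

text \<open>A function on \<open>[a,b]\<close> is represented by a function on the reals that is \<open>undefined\<close>
  outside \<open>[a,b]\<close>.\<close>

definition Cm_space :: "nat \<Rightarrow> real \<Rightarrow> real \<Rightarrow> (real \<Rightarrow> complex) cnspace" where
  "Cm_space m a b = \<lparr>
     carr = {u \<in> extensional {a..b}.
        (\<forall>j<m. nderiv a b j u differentiable_on {a..b}) \<and>
        continuous_on {a..b} (nderiv a b m u)},
     zro = (\<lambda>x\<in>{a..b}. 0),
     add = (\<lambda>u v. \<lambda>x\<in>{a..b}. u x + v x),
     scl = (\<lambda>c u. \<lambda>x\<in>{a..b}. c * u x),
     nrm = (\<lambda>u. sqrt (\<Sum>j\<le>m. integral {a..b} (\<lambda>x. (cmod (nderiv a b j u x))\<^sup>2)))\<rparr>"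

definition Hm_space :: "nat \<Rightarrow> real \<Rightarrow> real \<Rightarrow> (nat \<Rightarrow> real \<Rightarrow> complex) set cnspace" where
  "Hm_space m a b = cauchy_completion (Cm_space m a b)"


section \<open>The boundary spaces and the boundary values\<close>

definition L2_pair :: "real \<Rightarrow> real \<Rightarrow> (real \<Rightarrow> complex) cnspace" where
  "L2_pair a b = \<lparr>
     carr = {a, b} \<rightarrow>\<^sub>E UNIV,
     zro = (\<lambda>x\<in>{a, b}. 0),
     add = (\<lambda>\<phi> \<psi>. \<lambda>x\<in>{a, b}. \<phi> x + \<psi> x),
     scl = (\<lambda>c \<phi>. \<lambda>x\<in>{a, b}. c * \<phi> x),
     nrm = (\<lambda>\<phi>. sqrt ((cmod (\<phi> a))\<^sup>2 + (cmod (\<phi> b))\<^sup>2))\<rparr>"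

definition power_space :: "nat \<Rightarrow> 'v cnspace \<Rightarrow> (nat \<Rightarrow> 'v) cnspace" where
  "power_space m E = \<lparr>
     carr = {..<m} \<rightarrow>\<^sub>E carr E,
     zro = (\<lambda>k\<in>{..<m}. zro E),
     add = (\<lambda>\<Phi> \<Psi>. \<lambda>k\<in>{..<m}. add E (\<Phi> k) (\<Psi> k)),
     scl = (\<lambda>c \<Phi>. \<lambda>k\<in>{..<m}. scl E c (\<Phi> k)),
     nrm = (\<lambda>\<Phi>. sqrt (\<Sum>k<m. (nrm E (\<Phi> k))\<^sup>2))\<rparr>"

definition boundary_values :: "nat \<Rightarrow> real \<Rightarrow> real \<Rightarrow> (real \<Rightarrow> complex) \<Rightarrow> nat \<Rightarrow> real \<Rightarrow> complex" where
  "boundary_values m a b u = (\<lambda>j\<in>{..<m}. restrict (nderiv a b j u) {a, b})"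


section \<open>\<open>cauchy_completion\<close> yields a completion\<close>

context complex_normed_space
begin

lemma neg_add: "u \<in> carr E \<Longrightarrow> add E (scl E (-1) u) u = zro E"
  by (metis add_comm add_neg scl_closed)

lemma add_zro: "u \<in> carr E \<Longrightarrow> add E u (zro E) = u"
  by (metis add_comm zro_add zro_closed)

lemma scl_zro: "scl E c (zro E) = zro E"
proof -
  have "scl E c (zro E) = scl E c (add E (zro E) (scl E (-1) (zro E)))"
    by (simp add: add_neg zro_closed)
  also have "\<dots> = add E (scl E c (zro E)) (scl E (-1) (scl E c (zro E)))"
    by (simp add: scl_add scl_closed zro_closed scl_scl)
  finally show ?thesis
    by (simp add: add_neg scl_closed zro_closed)
qed

lemma nrm_zro: "nrm E (zro E) = 0"
  using nrm_scl[OF zro_closed, of 0] by (simp add: scl_zro)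

lemma nrm_neg: "u \<in> carr E \<Longrightarrow> nrm E (scl E (-1) u) = nrm E u"
  by (simp add: nrm_scl)

lemma nrm_nonneg: "u \<in> carr E \<Longrightarrow> 0 \<le> nrm E u"
  using nrm_triangle[of u "scl E (-1) u"] by (simp add: add_neg nrm_zro nrm_neg scl_closed)

lemma dst_nonneg: "\<lbrakk>u \<in> carr E; v \<in> carr E\<rbrakk> \<Longrightarrow> 0 \<le> dst E u v"
  by (simp add: dst_def nrm_nonneg add_closed scl_closed)

lemma dst_self: "u \<in> carr E \<Longrightarrow> dst E u u = 0"
  by (simp add: dst_def add_neg nrm_zro)

lemma dst_zro: "u \<in> carr E \<Longrightarrow> dst E u (zro E) = nrm E u"
  by (simp add: dst_def scl_zro add_zro)

lemma add_left_comm: "\<lbrakk>u \<in> carr E; v \<in> carr E; w \<in> carr E\<rbrakk> \<Longrightarrow>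
    add E u (add E v w) = add E v (add E u w)"
  by (metis add_assoc add_comm)

lemma add4: "\<lbrakk>u \<in> carr E; v \<in> carr E; x \<in> carr E; y \<in> carr E\<rbrakk> \<Longrightarrow>
    add E (add E u v) (add E x y) = add E (add E u x) (add E v y)"
  by (metis add_assoc add_comm add_closed)

lemma dst_sym: assumes "u \<in> carr E" "v \<in> carr E" shows "dst E u v = dst E v u"
proof -
  have "scl E (-1) (add E u (scl E (-1) v)) = add E v (scl E (-1) u)"
    using assms by (simp add: scl_add scl_closed scl_scl scl_one add_comm)
  then show ?thesis
    unfolding dst_def by (metis assms nrm_neg add_closed scl_closed)
qed

lemma dst_tri: assumes "u \<in> carr E" "v \<in> carr E" "w \<in> carr E"
  shows "dst E u w \<le> dst E u v + dst E v w"
proof -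
  have "add E (add E u (scl E (-1) v)) (add E v (scl E (-1) w)) = add E u (scl E (-1) w)"
    by (metis assms add_assoc add_closed scl_closed neg_add zro_add)
  then show ?thesis
    unfolding dst_def by (metis assms nrm_triangle add_closed scl_closed)
qed

lemma dst_add: assumes "u \<in> carr E" "v \<in> carr E" "x \<in> carr E" "y \<in> carr E"
  shows "dst E (add E u v) (add E x y) \<le> dst E u x + dst E v y"
proof -
  have "add E (add E u v) (scl E (-1) (add E x y)) =
      add E (add E u (scl E (-1) x)) (add E v (scl E (-1) y))"
    using assms by (simp add: scl_add scl_closed add4)
  then show ?thesis
    unfolding dst_def using assms by (simp add: nrm_triangle add_closed scl_closed)
qed

lemma dst_scl: assumes "u \<in> carr E" "v \<in> carr E"
  shows "dst E (scl E c u) (scl E c v) = cmod c * dst E u v"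
proof -
  have "add E (scl E c u) (scl E (-1) (scl E c v)) = scl E c (add E u (scl E (-1) v))"
    using assms by (simp add: scl_add scl_closed scl_scl)
  then show ?thesis
    unfolding dst_def using assms by (simp add: nrm_scl add_closed scl_closed)
qed

lemma nrm_dst: assumes "u \<in> carr E" "v \<in> carr E"
  shows "\<bar>nrm E u - nrm E v\<bar> \<le> dst E u v"
  using dst_tri[OF assms zro_closed] dst_tri[OF assms(2,1) zro_closed] assms
  by (simp add: dst_zro dst_sym[of v u])

lemma cauchyD: "X \<in> cauchy_seqs E \<Longrightarrow> X n \<in> carr E"
  by (simp add: cauchy_seqs_def)

lemma cauchyE: assumes "X \<in> cauchy_seqs E" "e > 0"
  obtains N where "\<And>i j. \<lbrakk>i \<ge> N; j \<ge> N\<rbrakk> \<Longrightarrow> dst E (X i) (X j) < e"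
  using assms unfolding cauchy_seqs_def by blast

lemma cauchy_const: "u \<in> carr E \<Longrightarrow> (\<lambda>n. u) \<in> cauchy_seqs E"
  by (simp add: cauchy_seqs_def dst_self)

lemma cauchy_add: assumes "X \<in> cauchy_seqs E" "Y \<in> cauchy_seqs E"
  shows "(\<lambda>n. add E (X n) (Y n)) \<in> cauchy_seqs E"
proof -
  have "\<exists>N. \<forall>i\<ge>N. \<forall>j\<ge>N. dst E (add E (X i) (Y i)) (add E (X j) (Y j)) < e" if "e > 0" for e
  proof -
    have e2: "e/2 > 0" using that by simp
    obtain N where N: "\<And>i j. \<lbrakk>i \<ge> N; j \<ge> N\<rbrakk> \<Longrightarrow> dst E (X i) (X j) < e/2"
      by (rule cauchyE[OF assms(1) e2]) blast
    obtain M where M: "\<And>i j. \<lbrakk>i \<ge> M; j \<ge> M\<rbrakk> \<Longrightarrow> dst E (Y i) (Y j) < e/2"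
      by (rule cauchyE[OF assms(2) e2]) blast
    have "dst E (add E (X i) (Y i)) (add E (X j) (Y j)) < e" if "i \<ge> max N M" "j \<ge> max N M" for i j
      using that dst_add[of "X i" "Y i" "X j" "Y j"] N[of i j] M[of i j] assms
      by (simp add: cauchyD)
    then show ?thesis by blast
  qed
  then show ?thesis
    using assms by (simp add: cauchy_seqs_def add_closed)
qed

lemma cauchy_scl: assumes "X \<in> cauchy_seqs E"
  shows "(\<lambda>n. scl E c (X n)) \<in> cauchy_seqs E"
proof -
  have "\<exists>N. \<forall>i\<ge>N. \<forall>j\<ge>N. dst E (scl E c (X i)) (scl E c (X j)) < e" if "e > 0" for e
  proof -
    have "0 < e / (cmod c + 1)"
      using \<open>e > 0\<close> by (simp add: add_nonneg_pos)
    then obtain N where N: "\<forall>i\<ge>N. \<forall>j\<ge>N. dst E (X i) (X j) < e / (cmod c + 1)"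
      using assms unfolding cauchy_seqs_def by blast
    have "dst E (scl E c (X i)) (scl E c (X j)) < e" if "i \<ge> N" "j \<ge> N" for i j
    proof -
      have "dst E (scl E c (X i)) (scl E c (X j)) \<le> (cmod c + 1) * dst E (X i) (X j)"
        using assms by (simp add: dst_scl cauchyD dst_nonneg distrib_right)
      also have "\<dots> < e"
        using N that by (simp add: add_nonneg_pos pos_less_divide_eq mult.commute)
      finally show ?thesis .
    qed
    then show ?thesis by blast
  qed
  then show ?thesis
    using assms by (simp add: cauchy_seqs_def scl_closed)
qed

lemma null_relI:
  assumes "X \<in> cauchy_seqs E" "Y \<in> cauchy_seqs E" "f \<longlonglongrightarrow> 0" "\<And>n. dst E (X n) (Y n) \<le> f n"
  shows "(X, Y) \<in> null_rel E"
proof -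
  have "(\<lambda>n. dst E (X n) (Y n)) \<longlonglongrightarrow> 0"
    by (rule tendsto_sandwich[OF _ _ tendsto_const assms(3)])
       (use assms in \<open>simp_all add: dst_nonneg cauchyD\<close>)
  then show ?thesis
    using assms by (simp add: null_rel_def)
qed

lemma equiv_null_rel: "equiv (cauchy_seqs E) (null_rel E)"
proof (rule equivI)
  show "null_rel E \<subseteq> cauchy_seqs E \<times> cauchy_seqs E"
    by (auto simp: null_rel_def)
  show "refl_on (cauchy_seqs E) (null_rel E)"
    by (auto simp: refl_on_def null_rel_def dst_self cauchyD)
  show "sym (null_rel E)"
    by (auto simp: sym_def null_rel_def dst_sym cauchyD)
  show "trans (null_rel E)"
  proof (rule transI)
    fix X Y Z assume "(X, Y) \<in> null_rel E" "(Y, Z) \<in> null_rel E"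
    then have c: "X \<in> cauchy_seqs E" "Y \<in> cauchy_seqs E" "Z \<in> cauchy_seqs E"
      and l: "(\<lambda>n. dst E (X n) (Y n) + dst E (Y n) (Z n)) \<longlonglongrightarrow> 0"
      by (auto simp: null_rel_def intro: tendsto_add_zero)
    show "(X, Z) \<in> null_rel E"
      by (rule null_relI[OF c(1,3) l]) (simp add: c cauchyD dst_tri)
  qed
qed

lemma carr_completion: "carr (cauchy_completion E) = cls E ` cauchy_seqs E"
  by (auto simp: cauchy_completion_def cls_def quotient_def)

lemma cls_eq_iff: "\<lbrakk>X \<in> cauchy_seqs E; Y \<in> cauchy_seqs E\<rbrakk> \<Longrightarrow>
    cls E X = cls E Y \<longleftrightarrow> (\<lambda>n. dst E (X n) (Y n)) \<longlonglongrightarrow> 0"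
  using eq_equiv_class_iff[OF equiv_null_rel] by (simp add: cls_def null_rel_def)

lemma mem_cls: "X \<in> cauchy_seqs E \<Longrightarrow> Y \<in> cls E X \<longleftrightarrow>
    Y \<in> cauchy_seqs E \<and> (\<lambda>n. dst E (X n) (Y n)) \<longlonglongrightarrow> 0"
  by (simp add: cls_def null_rel_def)

lemma add_cls: assumes "X \<in> cauchy_seqs E" "Y \<in> cauchy_seqs E"
  shows "add (cauchy_completion E) (cls E X) (cls E Y) = cls E (\<lambda>n. add E (X n) (Y n))"
proof -
  have eq: "cls E (\<lambda>n. add E (X' n) (Y' n)) = cls E (\<lambda>n. add E (X n) (Y n))"
    if "X' \<in> cls E X" "Y' \<in> cls E Y" for X' Y'
  proof -
    have c: "X' \<in> cauchy_seqs E" "Y' \<in> cauchy_seqs E"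
      and l: "(\<lambda>n. dst E (X n) (X' n) + dst E (Y n) (Y' n)) \<longlonglongrightarrow> 0"
      using that assms by (auto simp: mem_cls intro: tendsto_add_zero)
    have "(\<lambda>n. add E (X n) (Y n), \<lambda>n. add E (X' n) (Y' n)) \<in> null_rel E"
      by (rule null_relI[OF _ _ l]) (simp_all add: c assms cauchy_add cauchyD dst_add)
    then show ?thesis
      using equiv_class_eq[OF equiv_null_rel] by (simp add: cls_def)
  qed
  have ne: "cls E X \<noteq> {}" "cls E Y \<noteq> {}"
    using assms equiv_class_self[OF equiv_null_rel] by (auto simp: cls_def)
  have "add (cauchy_completion E) (cls E X) (cls E Y) =
      (\<Union>X'\<in>cls E X. \<Union>Y'\<in>cls E Y. cls E (\<lambda>n. add E (X' n) (Y' n)))"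
    by (simp add: cauchy_completion_def)
  also have "\<dots> = (\<Union>X'\<in>cls E X. \<Union>Y'\<in>cls E Y. cls E (\<lambda>n. add E (X n) (Y n)))"
    by (intro SUP_cong refl eq)
  finally show ?thesis using ne by simp
qed

lemma scl_cls: assumes "X \<in> cauchy_seqs E"
  shows "scl (cauchy_completion E) c (cls E X) = cls E (\<lambda>n. scl E c (X n))"
proof -
  have eq: "cls E (\<lambda>n. scl E c (X' n)) = cls E (\<lambda>n. scl E c (X n))" if "X' \<in> cls E X" for X'
  proof -
    have c: "X' \<in> cauchy_seqs E" and l: "(\<lambda>n. cmod c * dst E (X n) (X' n)) \<longlonglongrightarrow> 0"
      using that assms by (auto simp: mem_cls intro: tendsto_mult_right_zero)
    have "(\<lambda>n. scl E c (X n), \<lambda>n. scl E c (X' n)) \<in> null_rel E"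
      by (rule null_relI[OF _ _ l]) (simp_all add: c assms cauchy_scl cauchyD dst_scl)
    then show ?thesis
      using equiv_class_eq[OF equiv_null_rel] by (simp add: cls_def)
  qed
  have ne: "cls E X \<noteq> {}"
    using assms equiv_class_self[OF equiv_null_rel] by (auto simp: cls_def)
  have "scl (cauchy_completion E) c (cls E X) = (\<Union>X'\<in>cls E X. cls E (\<lambda>n. scl E c (X' n)))"
    by (simp add: cauchy_completion_def)
  also have "\<dots> = (\<Union>X'\<in>cls E X. cls E (\<lambda>n. scl E c (X n)))"
    by (intro SUP_cong refl eq)
  finally show ?thesis using ne by simp
qed

lemma nrm_cls_limit: assumes X: "X \<in> cauchy_seqs E"
  shows "(\<lambda>n. nrm E (X n)) \<longlonglongrightarrow> nrm (cauchy_completion E) (cls E X)"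
proof -
  have "Cauchy (\<lambda>n. nrm E (X n))"
  proof (rule metric_CauchyI)
    fix e :: real assume "e > 0"
    then obtain N where "\<forall>i\<ge>N. \<forall>j\<ge>N. dst E (X i) (X j) < e"
      using X unfolding cauchy_seqs_def by blast
    then show "\<exists>M. \<forall>m\<ge>M. \<forall>n\<ge>M. dist (nrm E (X m)) (nrm E (X n)) < e"
      using nrm_dst X by (metis cauchyD dist_real_def le_less_trans)
  qed
  then obtain r where r: "(\<lambda>n. nrm E (X n)) \<longlonglongrightarrow> r"
    using Cauchy_convergent convergent_def by blast
  have all: "(\<lambda>n. nrm E (Y n)) \<longlonglongrightarrow> r" if "Y \<in> cls E X" for Y
  proof -
    have Y: "Y \<in> cauchy_seqs E" "(\<lambda>n. dst E (X n) (Y n)) \<longlonglongrightarrow> 0"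
      using that X by (auto simp: mem_cls)
    have "(\<lambda>n. nrm E (X n) - nrm E (Y n)) \<longlonglongrightarrow> 0"
      by (rule Lim_null_comparison[OF _ Y(2)]) (simp add: nrm_dst X Y cauchyD)
    from tendsto_diff[OF r this] show ?thesis by simp
  qed
  have "X \<in> cls E X"
    using X by (simp_all add: mem_cls dst_self cauchyD)
  then have "(THE r. \<forall>Y\<in>cls E X. (\<lambda>n. nrm E (Y n)) \<longlonglongrightarrow> r) = r"
    by (intro the_equality) (use all r LIMSEQ_unique in blast)+
  then show ?thesis using r by (simp add: cauchy_completion_def)
qed

theorem completion_normed: "complex_normed_space (cauchy_completion E)"
proof -
  have z: "zro (cauchy_completion E) = cls E (\<lambda>n. zro E)"
    by (simp add: cauchy_completion_def)
  note c = cauchy_const[OF zro_closed] cauchy_add cauchy_scl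
  note s = carr_completion z add_cls scl_cls c cauchyD
  show ?thesis
  proof
    show "zro (cauchy_completion E) \<in> carr (cauchy_completion E)" by (simp add: s)
  next
    fix u v assume "u \<in> carr (cauchy_completion E)" "v \<in> carr (cauchy_completion E)"
    then obtain X Y where XY: "X \<in> cauchy_seqs E" "Y \<in> cauchy_seqs E" "u = cls E X" "v = cls E Y"
      by (auto simp: s)
    show "add (cauchy_completion E) u v \<in> carr (cauchy_completion E)"
      using XY by (simp add: s)
    show "add (cauchy_completion E) u v = add (cauchy_completion E) v u"
      using XY by (simp add: s add_comm)
    show "scl (cauchy_completion E) k (add (cauchy_completion E) u v) =
        add (cauchy_completion E) (scl (cauchy_completion E) k u) (scl (cauchy_completion E) k v)" for k
      using XY by (simp add: s scl_add)
    have "(\<lambda>n. nrm E (add E (X n) (Y n))) \<longlonglongrightarrow> nrm (cauchy_completion E) (add (cauchy_completion E) u v)"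
      using XY by (simp add: s nrm_cls_limit)
    moreover have "(\<lambda>n. nrm E (X n) + nrm E (Y n)) \<longlonglongrightarrow> nrm (cauchy_completion E) u + nrm (cauchy_completion E) v"
      using XY by (intro tendsto_add) (simp_all add: nrm_cls_limit)
    ultimately show "nrm (cauchy_completion E) (add (cauchy_completion E) u v)
        \<le> nrm (cauchy_completion E) u + nrm (cauchy_completion E) v"
      by (rule LIMSEQ_le) (use XY in \<open>simp add: nrm_triangle cauchyD\<close>)
    fix w assume "w \<in> carr (cauchy_completion E)"
    then obtain Z where Z: "Z \<in> cauchy_seqs E" "w = cls E Z"
      by (auto simp: s)
    show "add (cauchy_completion E) (add (cauchy_completion E) u v) w =
        add (cauchy_completion E) u (add (cauchy_completion E) v w)"
      using XY Z by (simp add: s add_assoc)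
  next
    fix u k l assume "u \<in> carr (cauchy_completion E)"
    then obtain X where X: "X \<in> cauchy_seqs E" "u = cls E X"
      by (auto simp: s)
    show "scl (cauchy_completion E) k u \<in> carr (cauchy_completion E)"
      and "add (cauchy_completion E) (zro (cauchy_completion E)) u = u"
      and "add (cauchy_completion E) u (scl (cauchy_completion E) (-1) u) = zro (cauchy_completion E)"
      and "scl (cauchy_completion E) 1 u = u"
      and "scl (cauchy_completion E) k (scl (cauchy_completion E) l u) = scl (cauchy_completion E) (k * l) u"
      and "scl (cauchy_completion E) (k + l) u = add (cauchy_completion E) (scl (cauchy_completion E) k u) (scl (cauchy_completion E) l u)"
      using X by (simp_all add: s zro_add add_neg scl_one scl_scl scl_plus)
    have "(\<lambda>n. nrm E (scl E k (X n))) \<longlonglongrightarrow> nrm (cauchy_completion E) (scl (cauchy_completion E) k u)"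
      using X by (simp add: s nrm_cls_limit)
    moreover have "(\<lambda>n. nrm E (scl E k (X n))) \<longlonglongrightarrow> cmod k * nrm (cauchy_completion E) u"
      using X tendsto_mult_left[OF nrm_cls_limit[OF X(1)], of "cmod k"]
      by (simp add: nrm_scl cauchyD)
    ultimately show "nrm (cauchy_completion E) (scl (cauchy_completion E) k u) = cmod k * nrm (cauchy_completion E) u"
      by (rule LIMSEQ_unique)
    show "u = zro (cauchy_completion E)" if "nrm (cauchy_completion E) u = 0"
      using X that nrm_cls_limit[OF X(1)] by (simp add: z cls_eq_iff c dst_zro cauchyD)
  qed
qed

theorem to_completion_closed: "u \<in> carr E \<Longrightarrow> to_completion E u \<in> carr (cauchy_completion E)"
  by (simp add: to_completion_def carr_completion cauchy_const)

theorem to_completion_add: "\<lbrakk>u \<in> carr E; v \<in> carr E\<rbrakk> \<Longrightarrow>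
    to_completion E (add E u v) = add (cauchy_completion E) (to_completion E u) (to_completion E v)"
  by (simp add: to_completion_def add_cls cauchy_const)

theorem to_completion_scl: "u \<in> carr E \<Longrightarrow>
    to_completion E (scl E c u) = scl (cauchy_completion E) c (to_completion E u)"
  by (simp add: to_completion_def scl_cls cauchy_const)

theorem nrm_to_completion: "u \<in> carr E \<Longrightarrow> nrm (cauchy_completion E) (to_completion E u) = nrm E u"
  using nrm_cls_limit[OF cauchy_const, of u] LIMSEQ_unique[OF tendsto_const]
  by (fastforce simp: to_completion_def)

lemma dst_cls_limit: assumes "X \<in> cauchy_seqs E" "Y \<in> cauchy_seqs E"
  shows "(\<lambda>n. dst E (X n) (Y n)) \<longlonglongrightarrow> dst (cauchy_completion E) (cls E X) (cls E Y)"
  using nrm_cls_limit[OF cauchy_add[OF assms(1) cauchy_scl[OF assms(2), of "-1"]]] assms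
  by (simp add: dst_def add_cls scl_cls cauchy_scl)

lemma cls_approx: assumes X: "X \<in> cauchy_seqs E" and "e > 0"
  shows "\<exists>N. \<forall>n\<ge>N. dst (cauchy_completion E) (cls E X) (to_completion E (X n)) < e"
proof -
  have e2: "e/2 > 0" using assms by simp
  obtain N where N: "\<And>i j. \<lbrakk>i \<ge> N; j \<ge> N\<rbrakk> \<Longrightarrow> dst E (X i) (X j) < e/2"
    by (rule cauchyE[OF X e2]) blast
  have "dst (cauchy_completion E) (cls E X) (to_completion E (X n)) < e" if "n \<ge> N" for n
  proof -
    have "(\<lambda>i. dst E (X i) (X n)) \<longlonglongrightarrow> dst (cauchy_completion E) (cls E X) (to_completion E (X n))"
      unfolding to_completion_def by (intro dst_cls_limit cauchy_const) (simp_all add: X cauchyD)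
    then have "dst (cauchy_completion E) (cls E X) (to_completion E (X n)) \<le> e/2"
      by (rule LIMSEQ_le_const2) (use N that in \<open>auto intro!: exI[of _ N] less_imp_le\<close>)
    then show ?thesis using \<open>e > 0\<close> by simp
  qed
  then show ?thesis by blast
qed

theorem to_completion_dense: "\<lbrakk>A \<in> carr (cauchy_completion E); e > 0\<rbrakk> \<Longrightarrow>
    \<exists>u\<in>carr E. dst (cauchy_completion E) A (to_completion E u) < e"
  unfolding carr_completion using cls_approx cauchyD by (metis imageE order_refl)

theorem completion_complete: assumes "A \<in> cauchy_seqs (cauchy_completion E)"
  shows "\<exists>L\<in>carr (cauchy_completion E). (\<lambda>n. dst (cauchy_completion E) (A n) L) \<longlonglongrightarrow> 0"
proof -
  interpret C: complex_normed_space "cauchy_completion E" by (rule completion_normed)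
  note A = C.cauchyD[OF assms]
  have "\<forall>k. \<exists>u\<in>carr E. dst (cauchy_completion E) (A k) (to_completion E u) < inverse (real (Suc k))"
    using to_completion_dense[OF A] by simp
  then obtain u where u: "\<And>k. u k \<in> carr E"
    and d: "\<And>k. dst (cauchy_completion E) (A k) (to_completion E (u k)) < inverse (real (Suc k))"
    by metis
  note uc = to_completion_closed[OF u]
  have iso: "dst E x y = dst (cauchy_completion E) (to_completion E x) (to_completion E y)"
    if "x \<in> carr E" "y \<in> carr E" for x y
    using that unfolding dst_def
    by (simp add: add_closed scl_closed flip: to_completion_add to_completion_scl nrm_to_completion)
  have "\<exists>N. \<forall>i\<ge>N. \<forall>j\<ge>N. dst E (u i) (u j) < e" if "e > 0" for e
  proof -
    have e3: "e / 3 > 0" using that by simp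
    obtain N where N: "\<forall>i\<ge>N. \<forall>j\<ge>N. dst (cauchy_completion E) (A i) (A j) < e/3"
      using assms e3 unfolding cauchy_seqs_def by blast
    obtain M where M: "inverse (real (Suc M)) < e/3"
      using reals_Archimedean[OF e3] by blast
    have M': "dst (cauchy_completion E) (A i) (to_completion E (u i)) < e/3" if "i \<ge> M" for i
    proof -
      have "inverse (real (Suc i)) \<le> inverse (real (Suc M))"
        using that by (intro le_imp_inverse_le) auto
      then show ?thesis using d[of i] M by linarith
    qed
    have "dst E (u i) (u j) < e" if "i \<ge> max N M" "j \<ge> max N M" for i j
    proof -
      have "dst E (u i) (u j) \<le> dst (cauchy_completion E) (to_completion E (u i)) (A i)
          + dst (cauchy_completion E) (A i) (to_completion E (u j))"
        unfolding iso[OF u u] by (intro C.dst_tri A uc)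
      also have "\<dots> \<le> dst (cauchy_completion E) (A i) (to_completion E (u i))
          + (dst (cauchy_completion E) (A i) (A j) + dst (cauchy_completion E) (A j) (to_completion E (u j)))"
        by (intro add_mono C.dst_tri A uc) (simp add: C.dst_sym A uc)
      also have "\<dots> < e/3 + (e/3 + e/3)"
        by (intro add_strict_mono M') (use N that in auto)
      finally show ?thesis by simp
    qed
    then show ?thesis by blast
  qed
  then have uC: "u \<in> cauchy_seqs E"
    by (simp add: cauchy_seqs_def u)
  let ?L = "cls E u"
  have L: "?L \<in> carr (cauchy_completion E)" by (simp add: carr_completion uC)
  have "(\<lambda>n. dst (cauchy_completion E) ?L (to_completion E (u n))) \<longlonglongrightarrow> 0"
    unfolding LIMSEQ_iff using cls_approx[OF uC] by (simp add: C.dst_nonneg L uc)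
  then have "(\<lambda>n. inverse (real (Suc n)) + dst (cauchy_completion E) ?L (to_completion E (u n))) \<longlonglongrightarrow> 0"
    by (intro tendsto_add_zero LIMSEQ_inverse_real_of_nat)
  then have "(\<lambda>n. dst (cauchy_completion E) (A n) ?L) \<longlonglongrightarrow> 0"
  proof (rule Lim_null_comparison[rotated], intro eventuallyI)
    fix n
    show "norm (dst (cauchy_completion E) (A n) ?L) \<le>
        inverse (real (Suc n)) + dst (cauchy_completion E) ?L (to_completion E (u n))"
      using C.dst_tri[OF A uc L, of n n] d[of n] C.dst_sym[OF L uc, of n] C.dst_nonneg[OF A L, of n]
      by simp
  qed
  then show ?thesis using L by blast
qed

end


section \<open>The spaces above are normed spaces\<close>

lemma normed_L2_pair: "complex_normed_space (L2_pair a b)"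
proof
  fix \<phi> \<psi> :: "real \<Rightarrow> complex"
  have "sqrt ((cmod (\<phi> a + \<psi> a))\<^sup>2 + (cmod (\<phi> b + \<psi> b))\<^sup>2)
      \<le> sqrt ((cmod (\<phi> a) + cmod (\<psi> a))\<^sup>2 + (cmod (\<phi> b) + cmod (\<psi> b))\<^sup>2)"
    by (intro real_sqrt_le_mono add_mono power_mono norm_triangle_ineq norm_ge_zero)
  also have "\<dots> \<le> sqrt ((cmod (\<phi> a))\<^sup>2 + (cmod (\<phi> b))\<^sup>2) + sqrt ((cmod (\<psi> a))\<^sup>2 + (cmod (\<psi> b))\<^sup>2)"
    by (rule real_sqrt_sum_squares_triangle_ineq)
  finally show "nrm (L2_pair a b) (add (L2_pair a b) \<phi> \<psi>) \<le> nrm (L2_pair a b) \<phi> + nrm (L2_pair a b) \<psi>"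
    by (simp add: L2_pair_def)
next
  fix c and \<phi> :: "real \<Rightarrow> complex"
  have "(cmod c)\<^sup>2 * (cmod (\<phi> a))\<^sup>2 + (cmod c)\<^sup>2 * (cmod (\<phi> b))\<^sup>2 =
      (cmod c)\<^sup>2 * ((cmod (\<phi> a))\<^sup>2 + (cmod (\<phi> b))\<^sup>2)"
    by (simp add: distrib_left)
  then show "nrm (L2_pair a b) (scl (L2_pair a b) c \<phi>) = cmod c * nrm (L2_pair a b) \<phi>"
    by (simp add: L2_pair_def norm_mult power_mult_distrib real_sqrt_mult)
qed (auto simp: L2_pair_def restrict_def PiE_iff extensional_def fun_eq_iff algebra_simps)

lemma normed_power_space: assumes "complex_normed_space E"
  shows "complex_normed_space (power_space m E)"
proof -
  interpret complex_normed_space E by fact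
  have nrm_eq: "nrm (power_space m E) \<Phi> = L2_set (\<lambda>k. nrm E (\<Phi> k)) {..<m}" for \<Phi>
    by (simp add: power_space_def L2_set_def)
  show ?thesis
  proof
    fix u v assume uv: "u \<in> carr (power_space m E)" "v \<in> carr (power_space m E)"
    have "nrm (power_space m E) (add (power_space m E) u v)
        \<le> L2_set (\<lambda>k. nrm E (u k) + nrm E (v k)) {..<m}"
      unfolding nrm_eq by (rule L2_set_mono)
        (use uv in \<open>auto simp: power_space_def PiE_iff nrm_triangle nrm_nonneg add_closed\<close>)
    also have "\<dots> \<le> nrm (power_space m E) u + nrm (power_space m E) v"
      unfolding nrm_eq by (rule L2_set_triangle_ineq)
    finally show "nrm (power_space m E) (add (power_space m E) u v)
        \<le> nrm (power_space m E) u + nrm (power_space m E) v" .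
  next
    fix u c assume u: "u \<in> carr (power_space m E)"
    have "nrm (power_space m E) (scl (power_space m E) c u) = L2_set (\<lambda>k. cmod c * nrm E (u k)) {..<m}"
      unfolding nrm_eq by (rule L2_set_cong)
        (use u in \<open>auto simp: power_space_def PiE_iff nrm_scl\<close>)
    then show "nrm (power_space m E) (scl (power_space m E) c u) = cmod c * nrm (power_space m E) u"
      by (simp add: nrm_eq L2_set_right_distrib)
  next
    fix u assume "u \<in> carr (power_space m E)" "nrm (power_space m E) u = 0"
    then show "u = zro (power_space m E)"
      unfolding nrm_eq
      by (auto simp: power_space_def PiE_iff fun_eq_iff extensional_def L2_set_eq_0_iff nrm_eq_0)
  qed (auto simp: power_space_def PiE_iff fun_eq_iff extensional_def restrict_def zro_closed add_closed
      scl_closed add_assoc add_comm add_left_comm add_zro add_neg scl_one scl_scl scl_add scl_plus)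
qed

lemma differentiable_on_cong:
  assumes "f differentiable_on S" "\<And>x. x \<in> S \<Longrightarrow> g x = f x"
  shows "g differentiable_on S"
  unfolding differentiable_on_def
proof
  fix x assume "x \<in> S"
  then show "g differentiable (at x within S)"
    using assms by (intro differentiable_transform_within[of f x S 1 g]) (auto simp: differentiable_on_def)
qed

lemma nderiv_linear:
  assumes "a < b"
    and "\<forall>j<m. nderiv a b j u differentiable_on {a..b}"
    and "\<forall>j<m. nderiv a b j v differentiable_on {a..b}"
    and w: "\<And>x. x \<in> {a..b} \<Longrightarrow> w x = c * u x + d * v x"
  shows "j \<le> m \<Longrightarrow> x \<in> {a..b} \<Longrightarrow> nderiv a b j w x = c * nderiv a b j u x + d * nderiv a b j v x"
proof (induction j arbitrary: x)
  case 0
  then show ?case by (simp add: w)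
next
  case (Suc j)
  have "(nderiv a b j u has_vector_derivative nderiv a b (Suc j) u x) (at x within {a..b})"
    "(nderiv a b j v has_vector_derivative nderiv a b (Suc j) v x) (at x within {a..b})"
    using assms(2,3) Suc.prems by (simp_all add: differentiable_on_def flip: vector_derivative_works)
  then have H: "((\<lambda>x. c * nderiv a b j u x + d * nderiv a b j v x) has_vector_derivative
      c * nderiv a b (Suc j) u x + d * nderiv a b (Suc j) v x) (at x within {a..b})"
    by (intro has_vector_derivative_add has_vector_derivative_mult_right)
  have "(nderiv a b j w has_vector_derivative
      c * nderiv a b (Suc j) u x + d * nderiv a b (Suc j) v x) (at x within {a..b})"
    by (rule has_vector_derivative_transform[OF Suc.prems(2) _ H]) (use Suc in simp)
  from vector_derivative_within_closed_interval[OF \<open>a < b\<close> Suc.prems(2) this] show ?case by simp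
qed

lemma nderiv_continuous:
  assumes "u \<in> carr (Cm_space m a b)" "j \<le> m"
  shows "continuous_on {a..b} (nderiv a b j u)"
  using assms by (cases "j = m") (auto simp: Cm_space_def intro: differentiable_imp_continuous_on)

lemma Cm_linear:
  assumes "a < b" "u \<in> carr (Cm_space m a b)" "v \<in> carr (Cm_space m a b)"
    and "w \<in> extensional {a..b}" "\<And>x. x \<in> {a..b} \<Longrightarrow> w x = c * u x + d * v x"
  shows "w \<in> carr (Cm_space m a b)"
    and "\<And>j x. \<lbrakk>j \<le> m; x \<in> {a..b}\<rbrakk> \<Longrightarrow> nderiv a b j w x = c * nderiv a b j u x + d * nderiv a b j v x"
proof -
  have D: "\<forall>j<m. nderiv a b j u differentiable_on {a..b}" "\<forall>j<m. nderiv a b j v differentiable_on {a..b}"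
    using assms by (auto simp: Cm_space_def)
  show nd: "nderiv a b j w x = c * nderiv a b j u x + d * nderiv a b j v x"
    if "j \<le> m" "x \<in> {a..b}" for j x
    using nderiv_linear[OF assms(1) D assms(5) that] .
  have "nderiv a b j w differentiable_on {a..b}" if "j < m" for j
  proof -
    have "(\<lambda>x. c * nderiv a b j u x + d * nderiv a b j v x) differentiable_on {a..b}"
      using D that by (auto simp: differentiable_on_def intro!: differentiable_add differentiable_mult)
    then show ?thesis
      by (rule differentiable_on_cong) (use nd that in auto)
  qed
  moreover have "continuous_on {a..b} (nderiv a b m w)"
  proof -
    have "continuous_on {a..b} (\<lambda>x. c * nderiv a b m u x + d * nderiv a b m v x)"
      using assms by (intro continuous_intros nderiv_continuous) auto
    then show ?thesis
      by (subst continuous_on_cong[OF refl nd]) auto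
  qed
  ultimately show "w \<in> carr (Cm_space m a b)"
    using assms by (simp add: Cm_space_def)
qed

lemma integral_minkowski:
  fixes f g :: "real \<Rightarrow> complex"
  assumes f: "continuous_on {a..b} f" and g: "continuous_on {a..b} g"
  shows "sqrt (integral {a..b} (\<lambda>x. (cmod (f x + g x))\<^sup>2))
    \<le> sqrt (integral {a..b} (\<lambda>x. (cmod (f x))\<^sup>2)) + sqrt (integral {a..b} (\<lambda>x. (cmod (g x))\<^sup>2))"
    (is "sqrt ?I \<le> sqrt ?F + sqrt ?G")
proof (rule field_le_epsilon)
  fix e :: real assume "e > 0"
  have int: "(\<lambda>x. (cmod (f x))\<^sup>2) integrable_on {a..b}" "(\<lambda>x. (cmod (g x))\<^sup>2) integrable_on {a..b}"
    "(\<lambda>x. (cmod (f x + g x))\<^sup>2) integrable_on {a..b}"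
    using f g by (auto intro!: integrable_continuous_real continuous_on_power continuous_on_norm continuous_on_add)
  have nn: "?F \<ge> 0" "?G \<ge> 0"
    by (auto intro!: integral_nonneg int)
  define p q where "p = sqrt ?F + e/2" and "q = sqrt ?G + e/2"
  have pq: "p > 0" "q > 0"
    using nn \<open>e > 0\<close> by (auto simp: p_def q_def add_nonneg_pos)
  have Fp: "?F \<le> p\<^sup>2" "?G \<le> q\<^sup>2"
    using nn \<open>e > 0\<close> by (auto simp: p_def q_def intro!: sqrt_le_D)
  have pw: "(cmod (f x + g x))\<^sup>2 \<le> (1 + q/p) * (cmod (f x))\<^sup>2 + (1 + p/q) * (cmod (g x))\<^sup>2" for x
  proof -
    define s t where "s = cmod (f x)" and "t = cmod (g x)"
    have "(cmod (f x + g x))\<^sup>2 \<le> (s + t)\<^sup>2"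
      unfolding s_def t_def by (intro power_mono norm_triangle_ineq norm_ge_zero)
    also have "\<dots> = (1 + q/p) * s\<^sup>2 + (1 + p/q) * t\<^sup>2 - (q * s - p * t)\<^sup>2 / (p * q)"
      using pq by (simp add: field_simps power2_eq_square)
    also have "\<dots> \<le> (1 + q/p) * s\<^sup>2 + (1 + p/q) * t\<^sup>2"
      using pq by simp
    finally show ?thesis by (simp add: s_def t_def)
  qed
  have "?I \<le> integral {a..b} (\<lambda>x. (1 + q/p) * (cmod (f x))\<^sup>2 + (1 + p/q) * (cmod (g x))\<^sup>2)"
    by (intro integral_le pw int integrable_add integrable_on_mult_right)
  also have "\<dots> = (1 + q/p) * ?F + (1 + p/q) * ?G"
    by (subst integral_add) (auto intro!: int integrable_on_mult_right)
  also have "\<dots> \<le> (1 + q/p) * p\<^sup>2 + (1 + p/q) * q\<^sup>2"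
    using pq Fp by (intro add_mono mult_left_mono) auto
  also have "\<dots> = (p + q)\<^sup>2"
    using pq by (simp add: field_simps power2_eq_square)
  finally have "sqrt ?I \<le> p + q"
    using pq by (simp add: real_le_lsqrt)
  then show "sqrt ?I \<le> sqrt ?F + sqrt ?G + e"
    by (simp add: p_def q_def)
qed

lemma normed_Cm_space: assumes ab: "a < b"
  shows "complex_normed_space (Cm_space m a b)"
proof -
  let ?E = "Cm_space m a b"
  define S where "S u j = sqrt (integral {a..b} (\<lambda>x. (cmod (nderiv a b j u x))\<^sup>2))" for u j
  have int: "(\<lambda>x. (cmod (nderiv a b j u x))\<^sup>2) integrable_on {a..b}" if "u \<in> carr ?E" "j \<le> m" for u j
    by (intro integrable_continuous_real continuous_on_power continuous_on_norm nderiv_continuous[OF that])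
  have nn: "0 \<le> integral {a..b} (\<lambda>x. (cmod (nderiv a b j u x))\<^sup>2)" if "u \<in> carr ?E" "j \<le> m" for u j
    using int[OF that] by (rule integral_nonneg) simp
  have nrm_eq: "nrm ?E u = L2_set (S u) {..m}" if "u \<in> carr ?E" for u
    using nn[OF that] by (simp add: L2_set_def S_def Cm_space_def)
  have add: "add ?E u v \<in> carr ?E"
    "\<And>j x. \<lbrakk>j \<le> m; x \<in> {a..b}\<rbrakk> \<Longrightarrow> nderiv a b j (add ?E u v) x = nderiv a b j u x + nderiv a b j v x"
    if "u \<in> carr ?E" "v \<in> carr ?E" for u v
    using Cm_linear[OF ab that, of "add ?E u v" 1 1] by (auto simp: Cm_space_def)
  have scl: "scl ?E c u \<in> carr ?E"
    "\<And>j x. \<lbrakk>j \<le> m; x \<in> {a..b}\<rbrakk> \<Longrightarrow> nderiv a b j (scl ?E c u) x = c * nderiv a b j u x"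
    if "u \<in> carr ?E" for u c
    using Cm_linear[OF ab that that, of "scl ?E c u" c 0] by (auto simp: Cm_space_def)
  have nderiv_const: "nderiv a b j (\<lambda>x\<in>{a..b}. 0) x = 0" if "x \<in> {a..b}" for j x
    using that
  proof (induction j arbitrary: x)
    case (Suc j)
    have "(nderiv a b j (\<lambda>x\<in>{a..b}. 0) has_vector_derivative 0) (at x within {a..b})"
      by (rule has_vector_derivative_transform[OF Suc.prems _ has_vector_derivative_const[of 0]])
        (rule Suc.IH)
    from vector_derivative_within_closed_interval[OF ab Suc.prems this]
    show ?case by (simp only: nderiv.simps)
  qed simp
  show ?thesis
  proof
    have "nderiv a b j (\<lambda>x\<in>{a..b}. 0) differentiable_on {a..b}" for j
      by (rule differentiable_on_cong[where f = "\<lambda>x. 0"]) (auto simp: nderiv_const)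
    then show "zro ?E \<in> carr ?E"
      by (simp add: Cm_space_def differentiable_imp_continuous_on)
  next
    fix u v assume uv: "u \<in> carr ?E" "v \<in> carr ?E"
    then show "add ?E u v \<in> carr ?E" by (rule add)
    have "S (add ?E u v) j \<le> S u j + S v j" if "j \<le> m" for j
    proof -
      have "integral {a..b} (\<lambda>x. (cmod (nderiv a b j (add ?E u v) x))\<^sup>2) =
          integral {a..b} (\<lambda>x. (cmod (nderiv a b j u x + nderiv a b j v x))\<^sup>2)"
        by (rule integral_cong) (simp add: add uv that)
      then show ?thesis
        using integral_minkowski[OF nderiv_continuous[OF uv(1) that] nderiv_continuous[OF uv(2) that]]
        by (simp only: S_def)
    qed
    then have "L2_set (S (add ?E u v)) {..m} \<le> L2_set (\<lambda>j. S u j + S v j) {..m}"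
      using add[OF uv] by (intro L2_set_mono) (auto simp: S_def nn)
    also have "\<dots> \<le> L2_set (S u) {..m} + L2_set (S v) {..m}"
      by (rule L2_set_triangle_ineq)
    finally show "nrm ?E (add ?E u v) \<le> nrm ?E u + nrm ?E v"
      using uv add[OF uv] by (simp add: nrm_eq)
  next
    fix u c assume u: "u \<in> carr ?E"
    then show "scl ?E c u \<in> carr ?E" by (rule scl)
    have "S (scl ?E c u) j = cmod c * S u j" if "j \<le> m" for j
    proof -
      have "integral {a..b} (\<lambda>x. (cmod (nderiv a b j (scl ?E c u) x))\<^sup>2) =
          integral {a..b} (\<lambda>x. (cmod c)\<^sup>2 * (cmod (nderiv a b j u x))\<^sup>2)"
        by (rule integral_cong) (simp add: scl u that norm_mult power_mult_distrib)
      then show ?thesis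
        by (simp add: S_def real_sqrt_mult)
    qed
    then have "L2_set (S (scl ?E c u)) {..m} = L2_set (\<lambda>j. cmod c * S u j) {..m}"
      by (intro L2_set_cong) auto
    then show "nrm ?E (scl ?E c u) = cmod c * nrm ?E u"
      using u scl[OF u] by (simp add: nrm_eq L2_set_right_distrib)
  next
    fix u assume u: "u \<in> carr ?E" and "nrm ?E u = 0"
    then have "S u 0 = 0"
      by (simp add: nrm_eq L2_set_eq_0_iff)
    then have "integral {a..b} (\<lambda>x. (cmod (u x))\<^sup>2) = 0"
      by (simp add: S_def)
    moreover have "continuous_on {a..b} (\<lambda>x. (cmod (u x))\<^sup>2)"
      using nderiv_continuous[OF u, of 0] by (auto intro!: continuous_intros)
    ultimately have "\<forall>x\<in>{a..b}. u x = 0"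
      using integral_eq_0_iff[of a b "\<lambda>x. (cmod (u x))\<^sup>2"] ab by auto
    then show "u = zro ?E"
      using u by (auto simp: Cm_space_def extensional_def fun_eq_iff)
  qed (auto simp: Cm_space_def extensional_def restrict_def fun_eq_iff algebra_simps)
qed

theorem Hm_space_Banach: assumes "a < b"
  shows "complex_normed_space (Hm_space m a b)"
    and "A \<in> cauchy_seqs (Hm_space m a b) \<Longrightarrow>
      \<exists>L\<in>carr (Hm_space m a b). (\<lambda>n. dst (Hm_space m a b) (A n) L) \<longlonglongrightarrow> 0"
proof -
  interpret complex_normed_space "Cm_space m a b" by (rule normed_Cm_space[OF assms])
  show "complex_normed_space (Hm_space m a b)"
    unfolding Hm_space_def by (rule completion_normed)
  show "\<exists>L\<in>carr (Hm_space m a b). (\<lambda>n. dst (Hm_space m a b) (A n) L) \<longlonglongrightarrow> 0"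
    if "A \<in> cauchy_seqs (Hm_space m a b)"
    using that unfolding Hm_space_def by (rule completion_complete)
qed

end

theory Submission
  imports Defs
begin

text \<open>A bounded linear operator from a normed space \<open>E\<close> to a complete normed space \<open>F\<close> extends
  uniquely to the completion of \<open>E\<close> (\<open>bounded_linear_op_extension\<close>): it maps Cauchy sequences to
  convergent ones, the limit depends only on the class of the sequence, and boundedness leaves no
  other choice of value because \<open>E\<close> is dense. The boundary space is complete, being a finite power
  of a two-dimensional space. What remains is analytic: the boundary values
  must be controlled by the Sobolev norm (\<open>trace_inequality\<close>). The fundamental theorem of
  calculus for \<open>(2 * x - a - b) * (cmod (f x))\<^sup>2\<close> does this at both end points at once, since the
  weight \<open>2 * x - a - b\<close> equals \<open>b - a\<close> at \<open>b\<close> and \<open>- (b - a)\<close> at \<open>a\<close>. Applied to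
  \<open>u\<^sup>(\<^sup>j\<^sup>)\<close> for each \<open>j < m\<close>, it bounds the squared boundary values by the integrals
  of \<open>\<bar>u\<^sup>(\<^sup>j\<^sup>)\<bar>\<^sup>2\<close> and \<open>\<bar>u\<^sup>(\<^sup>j\<^sup>+\<^sup>1\<^sup>)\<bar>\<^sup>2\<close>, which are summands of the squared
  Sobolev norm.\<close>


section \<open>Limits in normed spaces on explicit carriers\<close>

lemma (in complex_normed_space) limit_unique:
  assumes "\<And>n. X n \<in> carr E" "l \<in> carr E" "l' \<in> carr E"
    and "(\<lambda>n. dst E (X n) l) \<longlonglongrightarrow> 0" "(\<lambda>n. dst E (X n) l') \<longlonglongrightarrow> 0"
  shows "l = l'"
proof -
  have le: "dst E l l' \<le> dst E (X n) l + dst E (X n) l'" for n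
    using dst_tri[of l "X n" l'] dst_sym[of l "X n"] assms by simp
  have "(\<lambda>n. dst E (X n) l + dst E (X n) l') \<longlonglongrightarrow> 0"
    using assms(4,5) by (rule tendsto_add_zero)
  then have "dst E l l' \<le> 0"
    by (rule LIMSEQ_le_const) (use le in blast)
  with assms(2,3) have "nrm E (add E l (scl E (-1) l')) = 0"
    using dst_nonneg[of l l'] by (simp add: dst_def)
  then have "add E l (scl E (-1) l') = zro E"
    using assms by (intro nrm_eq_0 add_closed scl_closed)
  then have "add E (add E l (scl E (-1) l')) l' = l'"
    using assms by (simp add: zro_add)
  then show ?thesis
    using assms by (simp add: add_assoc scl_closed neg_add add_zro)
qed

lemma (in complex_normed_space) limit_add:
  assumes "\<And>n. X n \<in> carr E" "\<And>n. Y n \<in> carr E" "l \<in> carr E" "k \<in> carr E"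
    and "(\<lambda>n. dst E (X n) l) \<longlonglongrightarrow> 0" "(\<lambda>n. dst E (Y n) k) \<longlonglongrightarrow> 0"
  shows "(\<lambda>n. dst E (add E (X n) (Y n)) (add E l k)) \<longlonglongrightarrow> 0"
  by (rule tendsto_sandwich[OF _ _ tendsto_const tendsto_add_zero[OF assms(5,6)]])
    (simp_all add: assms dst_nonneg add_closed dst_add)

lemma (in complex_normed_space) limit_scl:
  assumes "\<And>n. X n \<in> carr E" "l \<in> carr E" "(\<lambda>n. dst E (X n) l) \<longlonglongrightarrow> 0"
  shows "(\<lambda>n. dst E (scl E c (X n)) (scl E c l)) \<longlonglongrightarrow> 0"
  using tendsto_mult_right_zero[OF assms(3), of "cmod c"] by (simp add: assms dst_scl)

lemma (in complex_normed_space) limit_nrm: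
  assumes "\<And>n. X n \<in> carr E" "l \<in> carr E" "(\<lambda>n. dst E (X n) l) \<longlonglongrightarrow> 0"
  shows "(\<lambda>n. nrm E (X n)) \<longlonglongrightarrow> nrm E l"
proof -
  have "(\<lambda>n. nrm E (X n) - nrm E l) \<longlonglongrightarrow> 0"
    by (rule Lim_null_comparison[OF _ assms(3)]) (simp add: nrm_dst assms)
  then show ?thesis by (simp add: LIM_zero_iff)
qed

definition complete_cn :: "'v cnspace \<Rightarrow> bool" where
  "complete_cn E \<longleftrightarrow>
     (\<forall>X\<in>cauchy_seqs E. \<exists>l\<in>carr E. (\<lambda>n. dst E (X n) l) \<longlonglongrightarrow> 0)"


section \<open>Extension of bounded linear operators to the completion\<close>

text \<open>Taking the constant positive makes it possible to divide by it when moduli of continuity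
  are chosen.\<close>

lemma bounded_linear_opE:
  assumes "complex_normed_space E" "bounded_linear_op E F T"
  obtains C where "C > 0" "\<And>u. u \<in> carr E \<Longrightarrow> nrm F (T u) \<le> C * nrm E u"
proof -
  interpret complex_normed_space E by fact
  obtain C where C: "\<And>u. u \<in> carr E \<Longrightarrow> nrm F (T u) \<le> C * nrm E u"
    using assms(2) by (auto simp: bounded_linear_op_def)
  have "nrm F (T u) \<le> (\<bar>C\<bar> + 1) * nrm E u" if "u \<in> carr E" for u
    using C[OF that] nrm_nonneg[OF that] mult_right_mono[of C "\<bar>C\<bar> + 1" "nrm E u"] by linarith
  then show ?thesis by (intro that[of "\<bar>C\<bar> + 1"]) auto
qed

lemma linear_op_dst:
  assumes "complex_normed_space E" "linear_op E F T" "u \<in> carr E" "v \<in> carr E"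
  shows "dst F (T u) (T v) = nrm F (T (add E u (scl E (-1) v)))"
  using assms by (simp add: linear_op_def dst_def complex_normed_space.scl_closed)

lemma bounded_linear_op_dst:
  assumes "complex_normed_space E" "bounded_linear_op E F T"
  obtains C where "C > 0"
    "\<And>u v. \<lbrakk>u \<in> carr E; v \<in> carr E\<rbrakk> \<Longrightarrow> dst F (T u) (T v) \<le> C * dst E u v"
proof -
  interpret complex_normed_space E by fact
  obtain C where C: "C > 0" "\<And>u. u \<in> carr E \<Longrightarrow> nrm F (T u) \<le> C * nrm E u"
    using bounded_linear_opE[OF assms] by blast
  have "dst F (T u) (T v) \<le> C * dst E u v" if "u \<in> carr E" "v \<in> carr E" for u v
    using C(2)[of "add E u (scl E (-1) v)"] that linear_op_dst[of E F T u v] assms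
    by (simp add: bounded_linear_op_def dst_def add_closed scl_closed)
  then show ?thesis using that C(1) by blast
qed

lemma linear_op_closed: "\<lbrakk>linear_op E F T; u \<in> carr E\<rbrakk> \<Longrightarrow> T u \<in> carr F"
  by (auto simp: linear_op_def)

lemma bounded_linear_op_cauchy:
  assumes "complex_normed_space E" "bounded_linear_op E F T" "X \<in> cauchy_seqs E"
  shows "(\<lambda>n. T (X n)) \<in> cauchy_seqs F"
proof -
  interpret complex_normed_space E by fact
  note X = cauchyD[OF assms(3)]
  obtain C where C: "C > 0" "\<And>u v. \<lbrakk>u \<in> carr E; v \<in> carr E\<rbrakk> \<Longrightarrow> dst F (T u) (T v) \<le> C * dst E u v"
    using bounded_linear_op_dst[OF assms(1,2)] by blast
  have "\<exists>N. \<forall>i\<ge>N. \<forall>j\<ge>N. dst F (T (X i)) (T (X j)) < e" if "e > 0" for e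
  proof -
    have "e / C > 0" using that C by simp
    then obtain N where N: "\<And>i j. \<lbrakk>i \<ge> N; j \<ge> N\<rbrakk> \<Longrightarrow> dst E (X i) (X j) < e / C"
      by (rule cauchyE[OF assms(3)]) blast
    have "dst F (T (X i)) (T (X j)) < e" if "i \<ge> N" "j \<ge> N" for i j
      using C(2)[OF X[of i] X[of j]] N[OF that] C(1) by (simp add: field_simps)
    then show ?thesis by blast
  qed
  moreover have "T (X n) \<in> carr F" for n
    using assms(2) linear_op_closed[OF _ X] by (auto simp: bounded_linear_op_def)
  ultimately show ?thesis by (simp add: cauchy_seqs_def)
qed

text \<open>Boundedness makes the images of equivalent Cauchy sequences approach each other, so one
  limit serves all representatives of a class; this makes the extension well defined.\<close>

lemma extension_value:
  assumes E: "complex_normed_space E" and F: "complex_normed_space F" "complete_cn F"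
    and L: "bounded_linear_op E F L" and A: "A \<in> carr (cauchy_completion E)"
  shows "\<exists>l\<in>carr F. \<forall>X\<in>A. (\<lambda>n. dst F (L (X n)) l) \<longlonglongrightarrow> 0"
proof -
  interpret E: complex_normed_space E by fact
  interpret F: complex_normed_space F by fact
  obtain Y where Y: "Y \<in> cauchy_seqs E" "A = cls E Y"
    using A by (auto simp: E.carr_completion)
  obtain l where l: "l \<in> carr F" "(\<lambda>n. dst F (L (Y n)) l) \<longlonglongrightarrow> 0"
    using bounded_linear_op_cauchy[OF E L Y(1)] F(2) by (auto simp: complete_cn_def)
  obtain C where C: "C > 0" "\<And>u v. \<lbrakk>u \<in> carr E; v \<in> carr E\<rbrakk> \<Longrightarrow> dst F (L u) (L v) \<le> C * dst E u v"
    using bounded_linear_op_dst[OF E L] by blast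
  have Lc: "L u \<in> carr F" if "u \<in> carr E" for u
    using L that by (auto simp: bounded_linear_op_def intro: linear_op_closed)
  have "(\<lambda>n. dst F (L (X n)) l) \<longlonglongrightarrow> 0" if "X \<in> A" for X
  proof -
    have X: "X \<in> cauchy_seqs E" "(\<lambda>n. dst E (Y n) (X n)) \<longlonglongrightarrow> 0"
      using that Y by (auto simp: E.mem_cls)
    have lim: "(\<lambda>n. C * dst E (Y n) (X n) + dst F (L (Y n)) l) \<longlonglongrightarrow> 0"
      using X(2) l(2) by (intro tendsto_add_zero tendsto_mult_right_zero)
    have "dst F (L (X n)) l \<le> C * dst E (Y n) (X n) + dst F (L (Y n)) l" for n
      using F.dst_tri[of "L (X n)" "L (Y n)" l] F.dst_sym[of "L (X n)" "L (Y n)"] C(2)[of "Y n" "X n"]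
        E.cauchyD[OF X(1), of n] E.cauchyD[OF Y(1), of n] l(1)
      by (simp add: Lc)
    then show ?thesis
      by (intro tendsto_sandwich[OF _ _ tendsto_const lim])
        (simp_all add: F.dst_nonneg Lc E.cauchyD[OF X(1)] l(1))
  qed
  then show ?thesis using l(1) by blast
qed

theorem bounded_linear_op_extension:
  assumes E: "complex_normed_space E" and F: "complex_normed_space F" "complete_cn F"
    and L: "bounded_linear_op E F L"
  shows "\<exists>!T. bounded_linear_op (cauchy_completion E) F T \<and>
              (\<forall>u\<in>carr E. T (to_completion E u) = L u)"
proof -
  interpret E: complex_normed_space E by fact
  interpret F: complex_normed_space F by fact
  let ?H = "cauchy_completion E"
  interpret H: complex_normed_space ?H by (rule E.completion_normed)
  have lin: "linear_op E F L" using L by (simp add: bounded_linear_op_def)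
  have Lc: "\<And>u. u \<in> carr E \<Longrightarrow> L u \<in> carr F" using lin by (rule linear_op_closed)
  have L_add: "L (add E u v) = add F (L u) (L v)" if "u \<in> carr E" "v \<in> carr E" for u v
    using lin that by (simp add: linear_op_def)
  have L_scl: "L (scl E c u) = scl F c (L u)" if "u \<in> carr E" for c u
    using lin that by (simp add: linear_op_def)
  obtain C where C: "C > 0" "\<And>u. u \<in> carr E \<Longrightarrow> nrm F (L u) \<le> C * nrm E u"
    using bounded_linear_opE[OF E L] by blast
  obtain S where S: "\<And>A. A \<in> carr ?H \<Longrightarrow> S A \<in> carr F"
      "\<And>A X. \<lbrakk>A \<in> carr ?H; X \<in> A\<rbrakk> \<Longrightarrow> (\<lambda>n. dst F (L (X n)) (S A)) \<longlonglongrightarrow> 0"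
    using extension_value[OF E F L] by metis
  define T where "T = restrict S (carr ?H)"
  have Tc: "T A \<in> carr F" if "A \<in> carr ?H" for A
    using S(1) that by (simp add: T_def)
  have clsc: "cls E X \<in> carr ?H" if "X \<in> cauchy_seqs E" for X
    using that by (simp add: E.carr_completion)
  have T_lim: "(\<lambda>n. dst F (L (X n)) (T (cls E X))) \<longlonglongrightarrow> 0" if "X \<in> cauchy_seqs E" for X
    using S(2)[OF clsc[OF that], of X] that clsc[OF that]
    by (simp add: T_def E.mem_cls E.dst_self E.cauchyD)
  have T_eq: "T (cls E X) = l"
    if "X \<in> cauchy_seqs E" "l \<in> carr F" "(\<lambda>n. dst F (L (X n)) l) \<longlonglongrightarrow> 0" for X l
    by (rule F.limit_unique[OF _ _ _ T_lim[OF that(1)] that(3)])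
      (simp_all add: that Lc E.cauchyD[OF that(1)] Tc clsc)
  have T_add: "T (add ?H A B) = add F (T A) (T B)" if "A \<in> carr ?H" "B \<in> carr ?H" for A B
  proof -
    obtain X Y where XY: "X \<in> cauchy_seqs E" "Y \<in> cauchy_seqs E" "A = cls E X" "B = cls E Y"
      using \<open>A \<in> carr ?H\<close> \<open>B \<in> carr ?H\<close> by (auto simp: E.carr_completion)
    have "(\<lambda>n. dst F (add F (L (X n)) (L (Y n))) (add F (T A) (T B))) \<longlonglongrightarrow> 0"
      using that T_lim XY by (intro F.limit_add) (simp_all add: Lc E.cauchyD Tc)
    then show ?thesis
      using that XY by (simp add: E.add_cls)
        (intro T_eq, simp_all add: E.cauchy_add F.add_closed Tc L_add E.cauchyD)
  qed
  have T_scl: "T (scl ?H c A) = scl F c (T A)" if "A \<in> carr ?H" for c A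
  proof -
    obtain X where X: "X \<in> cauchy_seqs E" "A = cls E X"
      using \<open>A \<in> carr ?H\<close> by (auto simp: E.carr_completion)
    have "(\<lambda>n. dst F (scl F c (L (X n))) (scl F c (T A))) \<longlonglongrightarrow> 0"
      using that T_lim X by (intro F.limit_scl) (simp_all add: Lc E.cauchyD Tc)
    then show ?thesis
      using that X by (simp add: E.scl_cls)
        (intro T_eq, simp_all add: E.cauchy_scl F.scl_closed Tc L_scl E.cauchyD)
  qed
  have T_bd: "nrm F (T A) \<le> C * nrm ?H A" if "A \<in> carr ?H" for A
  proof -
    obtain X where X: "X \<in> cauchy_seqs E" "A = cls E X"
      using \<open>A \<in> carr ?H\<close> by (auto simp: E.carr_completion)
    have "(\<lambda>n. nrm F (L (X n))) \<longlonglongrightarrow> nrm F (T A)"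
      using T_lim X that by (intro F.limit_nrm) (simp_all add: Lc E.cauchyD Tc)
    moreover have "(\<lambda>n. C * nrm E (X n)) \<longlonglongrightarrow> C * nrm ?H A"
      using X by (intro tendsto_mult_left) (simp add: E.nrm_cls_limit)
    ultimately show ?thesis
      by (rule LIMSEQ_le) (use C(2) X E.cauchyD in blast)
  qed
  have T_ext: "T (to_completion E u) = L u" if "u \<in> carr E" for u
    unfolding to_completion_def using that
    by (intro T_eq) (simp_all add: E.cauchy_const Lc F.dst_self)
  have T_ok: "bounded_linear_op ?H F T"
    unfolding bounded_linear_op_def linear_op_def
    using T_add T_scl T_bd Tc T_def by (intro conjI exI[of _ C]) auto
  show ?thesis
  proof (rule ex1I[of _ T])
    show "bounded_linear_op ?H F T \<and> (\<forall>u\<in>carr E. T (to_completion E u) = L u)"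
      using T_ok T_ext by blast
  next
    fix T' assume T': "bounded_linear_op ?H F T' \<and> (\<forall>u\<in>carr E. T' (to_completion E u) = L u)"
    then have lin': "linear_op ?H F T'" by (simp add: bounded_linear_op_def)
    obtain D where D: "D > 0"
      "\<And>A B. \<lbrakk>A \<in> carr ?H; B \<in> carr ?H\<rbrakk> \<Longrightarrow> dst F (T' A) (T' B) \<le> D * dst ?H A B"
      using bounded_linear_op_dst[OF E.completion_normed] T' by blast
    \<comment> \<open>A competitor is continuous, so its value at the class of \<open>X\<close> is the limit of its values
      at the embedded terms of \<open>X\<close>, where it agrees with \<open>L\<close>.\<close>
    have "T' A = T A" if A: "A \<in> carr ?H" for A
    proof -
      obtain X where X: "X \<in> cauchy_seqs E" "A = cls E X"
        using A by (auto simp: E.carr_completion)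
      note Xc = E.cauchyD[OF X(1)]
      note tc = E.to_completion_closed[OF Xc]
      have "(\<lambda>n. dst ?H (to_completion E (X n)) A) \<longlonglongrightarrow> 0"
        unfolding LIMSEQ_iff using E.cls_approx[OF X(1)]
        by (simp add: H.dst_nonneg tc A H.dst_sym[OF tc A] flip: X(2))
      then have lim: "(\<lambda>n. D * dst ?H (to_completion E (X n)) A) \<longlonglongrightarrow> 0"
        by (rule tendsto_mult_right_zero)
      have "dst F (L (X n)) (T' A) \<le> D * dst ?H (to_completion E (X n)) A" for n
        using D(2)[OF tc A] T' Xc by metis
      then have "(\<lambda>n. dst F (L (X n)) (T' A)) \<longlonglongrightarrow> 0"
        by (intro tendsto_sandwich[OF _ _ tendsto_const lim])
          (simp_all add: F.dst_nonneg Lc Xc linear_op_closed[OF lin' A])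
      then show ?thesis
        using T_eq[OF X(1) linear_op_closed[OF lin' A]] X(2) by simp
    qed
    moreover have "T' A = T A" if "A \<notin> carr ?H" for A
      using lin' that by (auto simp: linear_op_def T_def PiE_iff extensional_def)
    ultimately show "T' = T" by blast
  qed
qed


section \<open>Completeness of the boundary space\<close>

lemma complete_L2_pair: "complete_cn (L2_pair a b)"
  unfolding complete_cn_def
proof
  fix X assume X: "X \<in> cauchy_seqs (L2_pair a b)"
  have dst_eq: "dst (L2_pair a b) \<phi> \<psi> = sqrt ((cmod (\<phi> a - \<psi> a))\<^sup>2 + (cmod (\<phi> b - \<psi> b))\<^sup>2)" for \<phi> \<psi>
    by (simp add: dst_def L2_pair_def)
  have "\<exists>c. (\<lambda>n. X n p) \<longlonglongrightarrow> c" if "p \<in> {a, b}" for p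
  proof -
    have le: "cmod (X i p - X j p) \<le> dst (L2_pair a b) (X i) (X j)" for i j
      using that unfolding dst_eq by (auto intro!: real_le_rsqrt)
    have "Cauchy (\<lambda>n. X n p)"
    proof (rule metric_CauchyI)
      fix e :: real assume "e > 0"
      then obtain N where "\<forall>i\<ge>N. \<forall>j\<ge>N. dst (L2_pair a b) (X i) (X j) < e"
        using X unfolding cauchy_seqs_def by blast
      then show "\<exists>M. \<forall>m\<ge>M. \<forall>n\<ge>M. dist (X m p) (X n p) < e"
        using le unfolding dist_norm by (meson le_less_trans)
    qed
    then show ?thesis using Cauchy_convergent convergent_def by blast
  qed
  then obtain c where c: "\<And>p. p \<in> {a, b} \<Longrightarrow> (\<lambda>n. X n p) \<longlonglongrightarrow> c p" by metis
  have "(\<lambda>n. sqrt ((cmod (X n a - c a))\<^sup>2 + (cmod (X n b - c b))\<^sup>2))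
      \<longlonglongrightarrow> sqrt ((cmod (c a - c a))\<^sup>2 + (cmod (c b - c b))\<^sup>2)"
    by (intro tendsto_intros c) auto
  then have "(\<lambda>n. dst (L2_pair a b) (X n) (restrict c {a, b})) \<longlonglongrightarrow> 0"
    by (simp add: dst_eq)
  then show "\<exists>l\<in>carr (L2_pair a b). (\<lambda>n. dst (L2_pair a b) (X n) l) \<longlonglongrightarrow> 0"
    by (intro bexI[of _ "restrict c {a, b}"]) (auto simp: L2_pair_def)
qed

lemma complete_power_space:
  assumes "complex_normed_space E" "complete_cn E"
  shows "complete_cn (power_space m E)"
  unfolding complete_cn_def
proof
  interpret complex_normed_space E by fact
  let ?P = "power_space m E"
  fix X assume X: "X \<in> cauchy_seqs ?P"
  have Xc: "X n k \<in> carr E" if "k < m" for n k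
    using X that by (auto simp: cauchy_seqs_def power_space_def)
  have dst_eq: "dst ?P \<Phi> \<Psi> = sqrt (\<Sum>k<m. (dst E (\<Phi> k) (\<Psi> k))\<^sup>2)" for \<Phi> \<Psi>
    by (simp add: dst_def power_space_def)
  have "\<exists>c\<in>carr E. (\<lambda>n. dst E (X n k) c) \<longlonglongrightarrow> 0" if k: "k < m" for k
  proof -
    have le: "dst E (X i k) (X j k) \<le> dst ?P (X i) (X j)" for i j
      unfolding dst_eq using k
      by (intro real_le_rsqrt member_le_sum[of k "{..<m}" "\<lambda>k. (dst E (X i k) (X j k))\<^sup>2"]) auto
    have "\<exists>N. \<forall>i\<ge>N. \<forall>j\<ge>N. dst E (X i k) (X j k) < e" if "e > 0" for e
    proof -
      obtain N where "\<forall>i\<ge>N. \<forall>j\<ge>N. dst ?P (X i) (X j) < e"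
        using X \<open>e > 0\<close> unfolding cauchy_seqs_def by blast
      then show ?thesis using le by (meson le_less_trans)
    qed
    then have "(\<lambda>n. X n k) \<in> cauchy_seqs E"
      using Xc[OF k] by (simp add: cauchy_seqs_def)
    then show ?thesis using assms(2) by (simp add: complete_cn_def)
  qed
  then obtain c where c: "\<And>k. k < m \<Longrightarrow> c k \<in> carr E"
    "\<And>k. k < m \<Longrightarrow> (\<lambda>n. dst E (X n k) (c k)) \<longlonglongrightarrow> 0" by metis
  have "(\<lambda>n. sqrt (\<Sum>k<m. (dst E (X n k) (c k))\<^sup>2)) \<longlonglongrightarrow> sqrt (\<Sum>k<m. 0\<^sup>2)"
    by (intro tendsto_intros c) auto
  then have "(\<lambda>n. dst ?P (X n) (restrict c {..<m})) \<longlonglongrightarrow> 0"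
    by (simp add: dst_eq)
  then show "\<exists>l\<in>carr ?P. (\<lambda>n. dst ?P (X n) l) \<longlonglongrightarrow> 0"
    using c(1) by (intro bexI[of _ "restrict c {..<m}"]) (auto simp: power_space_def)
qed


section \<open>The trace inequality\<close>

text \<open>For \<open>w x = 2 * x - a - b\<close> the derivative of \<open>w * (cmod f)\<^sup>2\<close> is
  \<open>2 * (cmod f)\<^sup>2 + 2 * w * (f \<bullet> f')\<close>, and \<open>\<bar>w\<bar> \<le> b - a\<close> on the interval, so that
  Young's inequality \<open>2 * \<bar>f \<bullet> f'\<bar> \<le> (cmod f)\<^sup>2 + (cmod f')\<^sup>2\<close> bounds it by the right-hand
  integrands. Its integral is exactly the left-hand side.\<close>

lemma trace_inequality:
  fixes f f' :: "real \<Rightarrow> complex"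
  assumes "a < b"
    and deriv: "\<And>x. x \<in> {a..b} \<Longrightarrow> (f has_vector_derivative f' x) (at x within {a..b})"
    and cont: "continuous_on {a..b} f'"
  shows "(b - a) * ((cmod (f a))\<^sup>2 + (cmod (f b))\<^sup>2) \<le>
    (b - a + 2) * integral {a..b} (\<lambda>x. (cmod (f x))\<^sup>2) +
    (b - a) * integral {a..b} (\<lambda>x. (cmod (f' x))\<^sup>2)"
proof -
  have contf: "continuous_on {a..b} f"
    using deriv has_vector_derivative_continuous by (metis continuous_on_eq_continuous_within)
  have int: "(\<lambda>x. (cmod (f x))\<^sup>2) integrable_on {a..b}" "(\<lambda>x. (cmod (f' x))\<^sup>2) integrable_on {a..b}"
    by (intro integrable_continuous_real continuous_intros contf cont)+
  define g where "g x = 2 * (cmod (f x))\<^sup>2 + (2 * x - a - b) * (2 * (f x \<bullet> f' x))" for x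
  have "(g has_integral (2 * b - a - b) * (f b \<bullet> f b) - (2 * a - a - b) * (f a \<bullet> f a)) {a..b}"
  proof (rule fundamental_theorem_of_calculus)
    fix x assume "x \<in> {a..b}"
    from deriv[OF this] show
      "((\<lambda>x. (2 * x - a - b) * (f x \<bullet> f x)) has_vector_derivative g x) (at x within {a..b})"
      unfolding g_def has_vector_derivative_def
      by (auto intro!: derivative_eq_intros
          simp: fun_eq_iff algebra_simps power2_norm_eq_inner inner_commute)
  qed (use \<open>a < b\<close> in simp)
  then have g: "(g has_integral (b - a) * ((cmod (f a))\<^sup>2 + (cmod (f b))\<^sup>2)) {a..b}"
    by (simp add: power2_norm_eq_inner algebra_simps)
  have h: "((\<lambda>x. (b - a + 2) * (cmod (f x))\<^sup>2 + (b - a) * (cmod (f' x))\<^sup>2) has_integral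
      (b - a + 2) * integral {a..b} (\<lambda>x. (cmod (f x))\<^sup>2) +
      (b - a) * integral {a..b} (\<lambda>x. (cmod (f' x))\<^sup>2)) {a..b}"
    by (intro has_integral_add has_integral_mult_right integrable_integral int)
  show ?thesis
  proof (rule has_integral_le[OF g h])
    fix x assume x: "x \<in> {a..b}"
    have "2 * \<bar>f x \<bullet> f' x\<bar> \<le> 2 * (cmod (f x) * cmod (f' x))"
      using Cauchy_Schwarz_ineq2[of "f x" "f' x"] by simp
    also have "\<dots> \<le> (cmod (f x))\<^sup>2 + (cmod (f' x))\<^sup>2"
      using sum_squares_bound[of "cmod (f x)" "cmod (f' x)"] by simp
    finally have young: "\<bar>2 * (f x \<bullet> f' x)\<bar> \<le> (cmod (f x))\<^sup>2 + (cmod (f' x))\<^sup>2" by simp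
    have "(2 * x - a - b) * (2 * (f x \<bullet> f' x)) \<le> \<bar>2 * x - a - b\<bar> * \<bar>2 * (f x \<bullet> f' x)\<bar>"
      by (metis abs_ge_self abs_mult)
    also have "\<dots> \<le> (b - a) * ((cmod (f x))\<^sup>2 + (cmod (f' x))\<^sup>2)"
      using x young by (intro mult_mono) auto
    finally show "g x \<le> (b - a + 2) * (cmod (f x))\<^sup>2 + (b - a) * (cmod (f' x))\<^sup>2"
      by (simp add: g_def algebra_simps)
  qed
qed


section \<open>The boundary operator\<close>

lemma linear_boundary_values:
  assumes ab: "a < b"
  shows "linear_op (Cm_space m a b) (power_space m (L2_pair a b))
    (restrict (boundary_values m a b) (carr (Cm_space m a b)))"
proof -
  let ?E = "Cm_space m a b"
  interpret complex_normed_space ?E by (rule normed_Cm_space[OF ab])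
  have "boundary_values m a b (add ?E u v) =
      add (power_space m (L2_pair a b)) (boundary_values m a b u) (boundary_values m a b v)"
    if "u \<in> carr ?E" "v \<in> carr ?E" for u v
  proof -
    have "nderiv a b j (add ?E u v) x = nderiv a b j u x + nderiv a b j v x"
      if "j \<le> m" "x \<in> {a..b}" for j x
      using Cm_linear(2)[OF ab \<open>u \<in> carr ?E\<close> \<open>v \<in> carr ?E\<close>, of "add ?E u v" 1 1] that
      by (auto simp: Cm_space_def)
    then show ?thesis
      using ab by (auto simp: fun_eq_iff boundary_values_def power_space_def L2_pair_def)
  qed
  moreover have "boundary_values m a b (scl ?E c u) =
      scl (power_space m (L2_pair a b)) c (boundary_values m a b u)"
    if "u \<in> carr ?E" for c u
  proof -
    have "nderiv a b j (scl ?E c u) x = c * nderiv a b j u x" if "j \<le> m" "x \<in> {a..b}" for j x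
      using Cm_linear(2)[OF ab \<open>u \<in> carr ?E\<close> \<open>u \<in> carr ?E\<close>, of "scl ?E c u" c 0] that
      by (auto simp: Cm_space_def)
    then show ?thesis
      using ab by (auto simp: fun_eq_iff boundary_values_def power_space_def L2_pair_def)
  qed
  moreover have "boundary_values m a b u \<in> carr (power_space m (L2_pair a b))" for u
    by (auto simp: boundary_values_def power_space_def L2_pair_def)
  ultimately show ?thesis
    by (simp add: linear_op_def add_closed scl_closed)
qed

text \<open>Each integral \<open>I j\<close> of \<open>(cmod (nderiv a b j u x))\<^sup>2\<close> occurs at most twice when the trace
  inequality, divided by \<open>b - a\<close>, is summed over \<open>j < m\<close>: with factor \<open>1 + 2 / (b - a)\<close> as the
  integral of the function and with factor \<open>1\<close> as that of the derivative of its predecessor.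
  Together these give the constant \<open>2 + 2 / (b - a)\<close>, and only derivatives of order at most
  \<open>m\<close> are involved.\<close>

lemma boundary_values_bound:
  assumes ab: "a < b" and u: "u \<in> carr (Cm_space m a b)"
  shows "nrm (power_space m (L2_pair a b)) (boundary_values m a b u) \<le>
    sqrt (2 + 2 / (b - a)) * nrm (Cm_space m a b) u"
proof -
  define I where "I j = integral {a..b} (\<lambda>x. (cmod (nderiv a b j u x))\<^sup>2)" for j
  have I0: "0 \<le> I j" if "j \<le> m" for j
    unfolding I_def
    by (intro integral_nonneg integrable_continuous_real continuous_intros nderiv_continuous[OF u that])
      simp
  have bd: "(cmod (nderiv a b j u a))\<^sup>2 + (cmod (nderiv a b j u b))\<^sup>2 \<le> (1 + 2 / (b - a)) * I j + I (Suc j)"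
    if j: "j < m" for j
  proof -
    have "(nderiv a b j u has_vector_derivative nderiv a b (Suc j) u x) (at x within {a..b})"
      if "x \<in> {a..b}" for x
      using u j that by (simp add: Cm_space_def differentiable_on_def flip: vector_derivative_works)
    moreover have "continuous_on {a..b} (nderiv a b (Suc j) u)"
      using nderiv_continuous[OF u] j by (simp del: nderiv.simps)
    ultimately have "(b - a) * ((cmod (nderiv a b j u a))\<^sup>2 + (cmod (nderiv a b j u b))\<^sup>2)
        \<le> (b - a + 2) * I j + (b - a) * I (Suc j)"
      unfolding I_def by (rule trace_inequality[OF ab])
    also have "\<dots> = (b - a) * ((1 + 2 / (b - a)) * I j + I (Suc j))"
      using ab by (simp add: field_simps)
    finally show ?thesis using ab by simp
  qed
  have "(\<Sum>j<m. (cmod (nderiv a b j u a))\<^sup>2 + (cmod (nderiv a b j u b))\<^sup>2)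
      \<le> (\<Sum>j<m. (1 + 2 / (b - a)) * I j + I (Suc j))"
    using bd by (intro sum_mono) simp
  also have "\<dots> = (1 + 2 / (b - a)) * (\<Sum>j<m. I j) + (\<Sum>j<m. I (Suc j))"
    by (simp add: sum.distrib sum_distrib_left)
  also have "\<dots> \<le> (1 + 2 / (b - a)) * (\<Sum>j\<le>m. I j) + (\<Sum>j\<le>m. I j)"
  proof (intro add_mono mult_left_mono)
    show "(\<Sum>j<m. I j) \<le> (\<Sum>j\<le>m. I j)"
      using I0 by (intro sum_mono2) auto
    show "(\<Sum>j<m. I (Suc j)) \<le> (\<Sum>j\<le>m. I j)"
      using I0[of 0] by (simp add: sum.atMost_shift)
  qed (use ab in simp)
  also have "\<dots> = (2 + 2 / (b - a)) * (\<Sum>j\<le>m. I j)"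
    by (simp add: algebra_simps)
  finally have "sqrt (\<Sum>j<m. (cmod (nderiv a b j u a))\<^sup>2 + (cmod (nderiv a b j u b))\<^sup>2)
      \<le> sqrt (2 + 2 / (b - a)) * sqrt (\<Sum>j\<le>m. I j)"
    by (simp flip: real_sqrt_mult)
  then show ?thesis
    by (simp add: power_space_def L2_pair_def boundary_values_def Cm_space_def I_def)
qed

theorem theorem2p5:
  fixes a b :: real and m :: nat
  assumes "a < b" and "m > 1"
  shows "linear_op (Cm_space m a b) (power_space m (L2_pair a b))
           (restrict (boundary_values m a b) (carr (Cm_space m a b))) \<and>
         (\<exists>!T. bounded_linear_op (Hm_space m a b) (power_space m (L2_pair a b)) T \<and>
               (\<forall>u\<in>carr (Cm_space m a b).
                  T (to_completion (Cm_space m a b) u) = boundary_values m a b u))"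
proof -
  let ?E = "Cm_space m a b" and ?F = "power_space m (L2_pair a b)"
  let ?L = "restrict (boundary_values m a b) (carr ?E)"
  have lin: "linear_op ?E ?F ?L"
    using \<open>a < b\<close> by (rule linear_boundary_values)
  have "bounded_linear_op ?E ?F ?L"
    unfolding bounded_linear_op_def using lin boundary_values_bound[OF \<open>a < b\<close>] by auto
  then have "\<exists>!T. bounded_linear_op (cauchy_completion ?E) ?F T \<and>
      (\<forall>u\<in>carr ?E. T (to_completion ?E u) = ?L u)"
    using \<open>a < b\<close> by (intro bounded_linear_op_extension normed_Cm_space normed_power_space
        normed_L2_pair complete_power_space complete_L2_pair)
  with lin show ?thesis
    by (simp add: Hm_space_def)
qed

end
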